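(* Let $K\subset\mathbb R^2$ be a convex body with $0\in\operatorname{int}(K)$ and polar convex body $K^\circ$. The conjugate face map $\mathcal C_K:\mathcal F_K\to\mathcal E_{K^\circ}$ restricts to a surjection $$\mathcal F_K\setminus\mathcal E_K\;\longrightarrow\;\{\text{mixed corners of }K^\circ\}\cup\{\text{free corners of }K^\circ\}.$$ The restriction of $\mathcal C_K$ to $\mathcal F_K^{\rm mixed}$ is $1$-$1$ and the restriction of $\mathcal C_K$ to $\mathcal F_K^{\rm free}$ is $2$-$1$.
   Context: $\mathbb R^2$ carries the standard scalar product. A convex body is a compact convex set. The polar is $K^\circ=\{u\in\mathbb R^2\mid\langle u,v\rangle\le 1\ \forall v\in K\}$. Faces. A face of a convex set $C$ is a convex subset $F\subset C$ such that $x,y,z\in C$, $y\in F$ and $y\in\,]x,z[\,=\{(1-\lambda)x+\lambda z\mid 0<\lambda<1\}$ imply $x,z\in F$. Put $h_C(u)=\sup\{\langle x,u\rangle\mid x\in C\}$ and, for $u\ne 0$, $H_C(u)=\{x\mid\langle x,u\rangle=h_C(u)\}$. The exposed faces of $C$ are the non-empty sets $C\cap H_C(u)$, $u\neq 0$, together with $\emptyset$ and $C$. $\mathcal F_C\supset\mathcal E_C$ are the sets of faces and of exposed faces of $C$. A point $x$ with $\{x\}$ a face is an extremal point and is identified with the face $\{x\}$; it is exposed or non-exposed according to whether $\{x\}$ is an exposed face. (In the plane, $\mathcal F_K\setminus\mathcal E_K$ is exactly the set of non-exposed points of $K$.) Conjugate face: $\mathcal C_K(F)=\{v\in K^\circ\mid\langle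 v,u\rangle=1\ \forall u\in F\}$. Normal cones. For a convex body $C\subset\mathbb R^2$ with $0\in\operatorname{int}(C)$ and $x\in C$, $N(x)=\{u\mid\langle u,y-x\rangle\le 0\ \forall y\in C\}$; $\mathcal N_C$ is the set consisting of all $N(x)$, $x\in C$, and $\mathbb R^2$. A corner of $C$ is an extremal point $x$ with $\dim N(x)=2$; then $N(x)$ is a salient cone (i.e. $N(x)\cap(-N(x))=\{0\}$) having two distinct one-dimensional rays $r_1,r_2$ as faces. The corner $x$ is mixed if exactly one of $r_1,r_2$ belongs to $\mathcal N_C$, and free if $r_1,r_2\notin\mathcal N_C$. $\mathcal F_K^{\rm mixed}=\{x\in\mathcal F_K\setminus\mathcal E_K\mid\mathcal C_K(x)\text{ is a mixed corner of }K^\circ\}$ and $\mathcal F_K^{\rm free}=\{x\in\mathcal F_K\setminus\mathcal E_K\mid\mathcal C_K(x)\text{ is a free corner of }K^\circ\}$. "$2$-$1$" means that every free corner of $K^\circ$ has exactly two preimages in $\mathcal F_K^{\rm free}$; "$1$-$1$" means that every mixed corner of $K^\circ$ has exactly one preimage in $\mathcal F_K^{\rm mixed}$. *)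

theory Defs
  imports "HOL-Analysis.Analysis"
begin

definition polar_set :: "'a::real_inner set \<Rightarrow> 'a set" where
  "polar_set K = {u. \<forall>v\<in>K. u \<bullet> v \<le> 1}"

definition face_sets :: "'a::real_vector set \<Rightarrow> 'a set set" where
  "face_sets C = {F. F face_of C}"

text \<open>
  The library's \<open>exposed_face_of\<close> also allows the functional \<open>a = 0\<close>. This adds exactly
  the two conventional exposed faces: the empty set (\<open>0 = 1\<close>) and \<open>C\<close> itself (\<open>0 = 0\<close>).
  For \<open>a \<noteq> 0\<close> and a non-empty face the bound is the support value \<open>sup {x \<bullet> a | x \<in> C}\<close>.
\<close>

definition exposed_face_sets :: "'a::euclidean_space set \<Rightarrow> 'a set set" where
  "exposed_face_sets C = {F. F exposed_face_of C}"

definition conjugate_face :: "'a::real_inner set \<Rightarrow> 'a set \<Rightarrow> 'a set" where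
  "conjugate_face K F = {v \<in> polar_set K. \<forall>u\<in>F. v \<bullet> u = 1}"

definition normal_cone :: "'a::real_inner set \<Rightarrow> 'a \<Rightarrow> 'a set" where
  "normal_cone C x = {u. \<forall>y\<in>C. u \<bullet> (y - x) \<le> 0}"

definition normal_cones :: "'a::real_inner set \<Rightarrow> 'a set set" where
  "normal_cones C = insert UNIV (normal_cone C ` C)"

definition corner :: "(real^2) set \<Rightarrow> real^2 \<Rightarrow> bool" where
  "corner C x \<longleftrightarrow> x extreme_point_of C \<and> aff_dim (normal_cone C x) = 2"

definition boundary_rays :: "(real^2) set \<Rightarrow> real^2 \<Rightarrow> (real^2) set set" where
  "boundary_rays C x = {r. r face_of normal_cone C x \<and> aff_dim r = 1}"

definition mixed_corner :: "(real^2) set \<Rightarrow> real^2 \<Rightarrow> bool" where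
  "mixed_corner C x \<longleftrightarrow> corner C x \<and>
     (\<exists>r1 r2. r1 \<noteq> r2 \<and> boundary_rays C x = {r1, r2} \<and>
        r1 \<in> normal_cones C \<and> r2 \<notin> normal_cones C)"

definition free_corner :: "(real^2) set \<Rightarrow> real^2 \<Rightarrow> bool" where
  "free_corner C x \<longleftrightarrow> corner C x \<and>
     (\<exists>r1 r2. r1 \<noteq> r2 \<and> boundary_rays C x = {r1, r2} \<and>
        r1 \<notin> normal_cones C \<and> r2 \<notin> normal_cones C)"

text \<open>An extremal point \<open>x\<close> is identified with the face \<open>{x}\<close>, so corners are collected as singletons.\<close>

definition mixed_corners :: "(real^2) set \<Rightarrow> (real^2) set set" where
  "mixed_corners C = {{x} | x. mixed_corner C x}"

definition free_corners :: "(real^2) set \<Rightarrow> (real^2) set set" where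
  "free_corners C = {{x} | x. free_corner C x}"

definition mixed_faces :: "(real^2) set \<Rightarrow> (real^2) set set" where
  "mixed_faces K = {F \<in> face_sets K - exposed_face_sets K.
     conjugate_face K F \<in> mixed_corners (polar_set K)}"

definition free_faces :: "(real^2) set \<Rightarrow> (real^2) set set" where
  "free_faces K = {F \<in> face_sets K - exposed_face_sets K.
     conjugate_face K F \<in> free_corners (polar_set K)}"

end

theory Submission
  imports Defs
begin

text \<open>
  Everything is read off from the slices \<open>S\<^sub>u = {x \<in> K. \<langle>x,u\<rangle> = 1}\<close>, \<open>u \<in> K\<^sup>\<circ>\<close>. Since \<open>0\<close> is an
  interior point of \<open>K\<close>, these are exactly the intersections of \<open>K\<close> with its supporting lines,
  up to empty ones, and by the bipolar theorem the normal cone of \<open>K\<^sup>\<circ>\<close> at \<open>u\<close> is the cone over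
  \<open>S\<^sub>u\<close> (\<open>normal_cone_polar_set\<close>). In the plane \<open>S\<^sub>u\<close> is empty, a point or a segment, so
  \<open>u\<close> is a corner of \<open>K\<^sup>\<circ>\<close> precisely when \<open>S\<^sub>u\<close> is a segment \<open>[a,b]\<close> with \<open>a \<noteq> b\<close>
  (\<open>corner_imp_slice_segment\<close>, \<open>corner_of_slice_segment\<close>), and then the boundary rays of the normal
  cone are those spanned by \<open>a\<close> and \<open>b\<close>.

  The ray of a boundary point \<open>x\<close> of \<open>K\<close> is a normal cone of \<open>K\<^sup>\<circ>\<close> if and only if some slice is
  \<open>{x}\<close>, that is, if and only if \<open>x\<close> is exposed (\<open>ray_in_normal_cones_polar_set_iff\<close>). Hence a
  corner is mixed or free according to whether one or both end points of its slice are
  non-exposed.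

  Conversely, a non-exposed face is a single point \<open>x\<close> (\<open>nonexposed_face_obtains\<close>), and only one
  line supports \<open>K\<close> at \<open>x\<close>, since two would expose it. So the conjugate face of \<open>x\<close> is a single
  point \<open>u\<close>, and \<open>x\<close> is an end point of the segment \<open>S\<^sub>u\<close>. The fibre over \<open>{u}\<close> therefore
  consists of the non-exposed end points of \<open>S\<^sub>u\<close> (\<open>nonexposed_fibre\<close>), which gives the image
  and both counts.
\<close>

section \<open>Supporting slices and polarity\<close>

definition support_slice :: "'a::real_inner set \<Rightarrow> 'a \<Rightarrow> 'a set" where
  "support_slice K u = {x \<in> K. x \<bullet> u = 1}"

lemma polar_set_inner_le: "u \<in> polar_set K \<Longrightarrow> x \<in> K \<Longrightarrow> x \<bullet> u \<le> 1"
  by (auto simp: polar_set_def inner_commute)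

lemma convex_polar_set: "convex (polar_set K)"
proof -
  have "polar_set K = (\<Inter>v\<in>K. {u. v \<bullet> u \<le> 1})"
    by (auto simp: polar_set_def inner_commute)
  then show ?thesis
    by (simp add: convex_halfspace_le convex_INT)
qed

lemma zero_in_interior_polar_set:
  fixes K :: "'a::euclidean_space set"
  assumes "bounded K"
  shows "0 \<in> interior (polar_set K)"
proof -
  obtain B where B: "B > 0" "\<And>x. x \<in> K \<Longrightarrow> norm x \<le> B"
    using assms bounded_pos by blast
  have "ball 0 (1 / B) \<subseteq> polar_set K"
  proof
    fix u :: 'a assume "u \<in> ball 0 (1 / B)"
    then have u: "norm u * B \<le> 1"
      using B(1) by (simp add: field_simps less_imp_le)
    have "u \<bullet> v \<le> 1" if "v \<in> K" for v
    proof -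
      have "u \<bullet> v \<le> norm u * norm v"
        by (rule norm_cauchy_schwarz)
      also have "\<dots> \<le> norm u * B"
        using B(2)[OF that] by (simp add: mult_left_mono)
      finally show ?thesis
        using u by linarith
    qed
    then show "u \<in> polar_set K"
      by (simp add: polar_set_def)
  qed
  then show ?thesis
    using B(1) by (meson centre_in_ball interior_maximal open_ball subsetD zero_less_divide_1_iff)
qed

text \<open>
  The bipolar theorem: a hyperplane separating a point \<open>z\<close> from \<open>K\<close> misses \<open>0 \<in> K\<close>, so its normal,
  scaled by the (negative) level \<open>b\<close>, is a point of the polar at which \<open>z\<close> exceeds \<open>1\<close>.
\<close>
lemma polar_set_polar_set:
  fixes K :: "'a::euclidean_space set"
  assumes "convex K" "closed K" "0 \<in> K"
  shows "polar_set (polar_set K) = K"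
proof
  show "K \<subseteq> polar_set (polar_set K)"
    by (auto simp: polar_set_def inner_commute)
  show "polar_set (polar_set K) \<subseteq> K"
  proof (rule ccontr)
    assume "\<not> polar_set (polar_set K) \<subseteq> K"
    then obtain z where z: "z \<in> polar_set (polar_set K)" "z \<notin> K" by auto
    obtain a b where ab: "a \<bullet> z < b" "\<And>x. x \<in> K \<Longrightarrow> a \<bullet> x > b"
      using separating_hyperplane_closed_point[OF assms(1,2) z(2)] by blast
    have b: "b < 0"
      using ab(2)[OF assms(3)] by simp
    have "(1 / b) *\<^sub>R a \<in> polar_set K"
      using b ab(2) by (auto simp: polar_set_def field_simps less_imp_le)
    then have "z \<bullet> ((1 / b) *\<^sub>R a) \<le> 1"
      by (metis polar_set_inner_le[OF z(1)] inner_commute)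
    then show False
      using b ab(1) by (simp add: field_simps inner_commute)
  qed
qed

lemma support_slice_exposed:
  fixes K :: "'a::euclidean_space set"
  assumes "convex K" "u \<in> polar_set K"
  shows "support_slice K u exposed_face_of K"
proof -
  have "support_slice K u = K \<inter> {x. u \<bullet> x = 1}"
    by (auto simp: support_slice_def inner_commute)
  then show ?thesis
    using exposed_face_of_Int_supporting_hyperplane_le[OF assms(1), of u 1] assms(2)
    by (simp add: polar_set_def)
qed

text \<open>
  A conjugate face is an intersection of slices of the polar; over the empty face it is the whole
  polar, which counts as exposed.
\<close>
lemma conjugate_face_exposed:
  fixes K :: "'a::euclidean_space set"
  assumes "F \<subseteq> K"
  shows "conjugate_face K F exposed_face_of polar_set K"
proof (cases "F = {}")
  case True
  then show ?thesis
    by (simp add: conjugate_face_def convex_polar_set)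
next
  case False
  have "conjugate_face K F = (\<Inter>x\<in>F. support_slice (polar_set K) x)"
    using False by (auto simp: conjugate_face_def support_slice_def)
  moreover have "support_slice (polar_set K) x exposed_face_of polar_set K" if "x \<in> F" for x
    using that assms
    by (intro support_slice_exposed convex_polar_set) (auto simp: polar_set_def inner_commute)
  ultimately show ?thesis
    using exposed_face_of_Inter[of "support_slice (polar_set K) ` F" "polar_set K"] False
    by (simp add: image_iff ball_simps) (metis imageE)
qed

text \<open>
  A face other than the body misses the interior, so a relative interior point of it lies on a
  supporting hyperplane, which then contains the face; since \<open>0\<close> is interior, it misses \<open>0\<close> and can be normalised.
\<close>
lemma proper_face_subset_support_slice:
  fixes K :: "'a::euclidean_space set"
  assumes "convex K" "0 \<in> interior K" "F face_of K" "F \<noteq> {}" "F \<noteq> K"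
  obtains u where "u \<in> polar_set K" "F \<subseteq> support_slice K u"
proof -
  have "convex F"
    using assms(3) face_of_imp_convex by blast
  then obtain z where z: "z \<in> rel_interior F"
    using assms(4) rel_interior_eq_empty by blast
  have zF: "z \<in> F"
    using z rel_interior_subset by (rule subsetD[rotated])
  have zK: "z \<in> K" "z \<notin> rel_interior K"
    using zF face_of_imp_subset[OF assms(3)] face_of_disjoint_rel_interior[OF assms(3,5)]
    by auto
  obtain a where a: "\<And>y. y \<in> K \<Longrightarrow> a \<bullet> z \<le> a \<bullet> y"
      "\<And>y. y \<in> rel_interior K \<Longrightarrow> a \<bullet> z < a \<bullet> y"
    using supporting_hyperplane_rel_boundary[OF assms(1) zK] by metis
  have neg: "a \<bullet> z < 0"
    using a(2)[of 0] assms(2) interior_subset_rel_interior by fastforce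
  define u where "u = (1 / (a \<bullet> z)) *\<^sub>R a"
  have u: "u \<in> polar_set K"
    using neg a(1) by (auto simp: u_def polar_set_def field_simps)
  have "z \<in> support_slice K u"
    using neg zK(1) by (simp add: u_def support_slice_def inner_commute)
  then have "support_slice K u \<inter> rel_interior F \<noteq> {}"
    using z by auto
  then have "F \<subseteq> support_slice K u"
    using subset_of_face_of[of "support_slice K u" K F] support_slice_exposed[OF assms(1) u]
      face_of_imp_subset[OF assms(3)] by (simp add: exposed_face_of_def)
  then show ?thesis
    using u that by blast
qed

section \<open>Normal cones of the polar body\<close>

text \<open>
  A non-zero normal vector of the polar at \<open>u\<close> is positive at \<open>u\<close>, because \<open>0\<close> is an interior
  point of the polar; scaled to the value \<open>1\<close> at \<open>u\<close>, it lies in the bipolar, which is \<open>K\<close>.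
\<close>
lemma normal_cone_polar_set:
  fixes K :: "'a::euclidean_space set"
  assumes "convex K" "compact K" "0 \<in> K" "u \<in> polar_set K"
  shows "normal_cone (polar_set K) u = insert 0 (conic hull (support_slice K u))"
proof
  show "normal_cone (polar_set K) u \<subseteq> insert 0 (conic hull (support_slice K u))"
  proof
    fix w assume w: "w \<in> normal_cone (polar_set K) u"
    show "w \<in> insert 0 (conic hull (support_slice K u))"
    proof (cases "w = 0")
      case False
      obtain e where e: "e > 0" "cball 0 e \<subseteq> polar_set K"
        using zero_in_interior_polar_set[of K] assms(2) compact_imp_bounded mem_interior_cball
        by blast
      have le: "w \<bullet> v \<le> w \<bullet> u" if "v \<in> polar_set K" for v
        using w that by (simp add: normal_cone_def inner_diff_right)
      have "(e / norm w) *\<^sub>R w \<in> polar_set K"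
        using e False by (intro subsetD[OF e(2)]) simp
      then have "w \<bullet> ((e / norm w) *\<^sub>R w) \<le> w \<bullet> u"
        by (rule le)
      moreover have "w \<bullet> ((e / norm w) *\<^sub>R w) > 0"
        using e(1) False by simp
      ultimately have pos: "w \<bullet> u > 0" by linarith
      define k where "k = (1 / (w \<bullet> u)) *\<^sub>R w"
      have "k \<in> polar_set (polar_set K)"
        using le pos by (auto simp: k_def polar_set_def field_simps)
      then have "k \<in> support_slice K u"
        using polar_set_polar_set[OF assms(1) compact_imp_closed[OF assms(2)] assms(3)] pos
        by (simp add: support_slice_def k_def)
      moreover have "w = (w \<bullet> u) *\<^sub>R k"
        using pos by (simp add: k_def)
      ultimately show ?thesis
        using pos by (auto simp: conic_hull_explicit) (metis less_imp_le)
    qed simp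
  qed
  show "insert 0 (conic hull (support_slice K u)) \<subseteq> normal_cone (polar_set K) u"
  proof
    fix w assume "w \<in> insert 0 (conic hull (support_slice K u))"
    then consider "w = 0" | t k where "t \<ge> 0" "k \<in> K" "k \<bullet> u = 1" "w = t *\<^sub>R k"
      by (auto simp: conic_hull_explicit support_slice_def)
    then show "w \<in> normal_cone (polar_set K) u"
    proof cases
      case 2
      have "t * (k \<bullet> v) \<le> t" if "v \<in> polar_set K" for v
        using 2 polar_set_inner_le[OF that \<open>k \<in> K\<close>] by (simp add: mult_left_le)
      then show ?thesis
        using 2 by (simp add: normal_cone_def inner_diff_right algebra_simps)
    qed (simp add: normal_cone_def)
  qed
qed

text \<open>
  If the normal cone at \<open>v\<close> is the ray of \<open>x\<close>, then \<open>v\<close> attains the value \<open>1\<close> on \<open>K\<close> at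
  positive multiples of \<open>x\<close> only; the bound \<open>\<langle>x,v\<rangle> \<le> 1\<close> and the bound by the hyperplane through \<open>x\<close> with normal \<open>u\<close>
  force the multiple to be \<open>1\<close>, so the slice of \<open>v\<close> exposes \<open>x\<close>. Conversely, an
  exposing functional can be normalised to a point of the polar whose slice is \<open>{x}\<close>.
\<close>
lemma ray_in_normal_cones_polar_set_iff:
  fixes K :: "'a::euclidean_space set"
  assumes K: "convex K" "compact K" "0 \<in> interior K"
    and u: "u \<in> polar_set K" and x: "x \<in> support_slice K u"
  shows "conic hull {x} \<in> normal_cones (polar_set K) \<longleftrightarrow> {x} exposed_face_of K"
proof
  have K0: "0 \<in> K"
    using K(3) interior_subset by blast
  have xK: "x \<in> K" "x \<bullet> u = 1"
    using x by (auto simp: support_slice_def)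
  then have x0: "x \<noteq> 0" by auto
  {
    assume "conic hull {x} \<in> normal_cones (polar_set K)"
    \<comment> \<open>rules out the improper member \<open>UNIV\<close> of the set of normal cones\<close>
    moreover have "- x \<notin> conic hull {x}"
    proof
      assume "- x \<in> conic hull {x}"
      then obtain t where "t \<ge> 0" "- x = t *\<^sub>R x"
        by (auto simp: conic_hull_explicit)
      then have "(- x) \<bullet> u = t * (x \<bullet> u)"
        by (metis inner_scaleR_left)
      then show False
        using xK(2) \<open>t \<ge> 0\<close> by simp
    qed
    ultimately obtain v where v: "v \<in> polar_set K" "conic hull {x} = normal_cone (polar_set K) v"
      by (auto simp: normal_cones_def)
    then have eq: "conic hull {x} = insert 0 (conic hull (support_slice K v))"
      using normal_cone_polar_set K K0 by blast
    have "x \<in> conic hull {x}"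
      by (simp add: hull_inc)
    then obtain t k where tk: "t \<ge> 0" "k \<in> support_slice K v" "x = t *\<^sub>R k"
      using eq x0 by (auto simp: conic_hull_explicit)
    have "t = x \<bullet> v" and "t * (k \<bullet> u) = 1"
      using tk xK(2) by (auto simp: support_slice_def)
    moreover have "x \<bullet> v \<le> 1" "k \<bullet> u \<le> 1"
      using polar_set_inner_le v(1) u xK(1) tk(2) by (auto simp: support_slice_def)
    ultimately have "t = 1"
      using tk(1) by (smt (verit) mult_left_le)
    then have xv: "x \<in> support_slice K v" "x \<bullet> v = 1"
      using tk by (auto simp: support_slice_def)
    have "y = x" if "y \<in> support_slice K v" for y
    proof -
      have "y \<in> conic hull {x}"
        using that eq by (simp add: hull_inc)
      then obtain s where "y = s *\<^sub>R x"
        by (auto simp: conic_hull_explicit)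
      then show ?thesis
        using that xv(2) by (simp add: support_slice_def)
    qed
    then have "support_slice K v = {x}"
      using xv(1) by blast
    then show "{x} exposed_face_of K"
      using support_slice_exposed[OF K(1) v(1)] by simp
  }
  {
    assume "{x} exposed_face_of K"
    then obtain a b where ab: "K \<subseteq> {y. a \<bullet> y \<le> b}" "{x} = K \<inter> {y. a \<bullet> y = b}"
      by (auto simp: exposed_face_of_def)
    have "b \<ge> 0" "b \<noteq> 0"
      using ab K0 x0 by auto
    then have "b > 0" by simp
    define v where "v = (1 / b) *\<^sub>R a"
    have "v \<in> polar_set K"
      using ab(1) \<open>b > 0\<close> by (auto simp: v_def polar_set_def field_simps)
    moreover have "support_slice K v = {x}"
      unfolding ab(2) using \<open>b > 0\<close>
      by (auto simp: v_def support_slice_def inner_commute field_simps)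
    ultimately have "normal_cone (polar_set K) v = conic hull {x}"
      using normal_cone_polar_set[OF K(1,2) K0, of v]
      by (simp add: insert_absorb)
    then show "conic hull {x} \<in> normal_cones (polar_set K)"
      using \<open>v \<in> polar_set K\<close> by (auto simp: normal_cones_def)
  }
qed

section \<open>Rays bounding the cone over a segment\<close>

lemma aff_dim_ray:
  fixes a :: "'a::euclidean_space"
  assumes "a \<noteq> 0"
  shows "aff_dim (conic hull {a}) = 1"
proof (rule antisym)
  have "conic hull {a} \<subseteq> span {a}"
    by (rule hull_minimal) (auto simp: span_base conic_span)
  then have "aff_dim (conic hull {a}) \<le> aff_dim (span {a})"
    by (rule aff_dim_subset)
  also have "\<dots> = 1"
    using assms by (simp add: aff_dim_subspace)
  finally show "aff_dim (conic hull {a}) \<le> 1" .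
  have "{0, a} \<subseteq> conic hull {a}"
    by (auto simp: hull_inc)
  then have "aff_dim {0, a} \<le> aff_dim (conic hull {a})"
    by (rule aff_dim_subset)
  then show "1 \<le> aff_dim (conic hull {a})"
    using assms by (simp add: aff_dim_2)
qed

text \<open>
  Here and below, the height functional \<open>u\<close> keeps the segment on a line off the origin, so that
  \<open>a \<noteq> b\<close> makes the two end points linearly independent.
\<close>
lemma ray_face_of_cone_over_segment:
  fixes a b u :: "'a::euclidean_space"
  assumes ab: "a \<noteq> b" "a \<bullet> u = 1" "b \<bullet> u = 1"
  shows "conic hull {a} face_of conic hull (closed_segment a b)"
proof -
  have a0: "a \<noteq> 0"
    using ab(2) by auto
  \<comment> \<open>the part of \<open>b\<close> orthogonal to \<open>a\<close> is a functional that exposes the ray of \<open>a\<close>\<close>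
  define w where "w = b - ((a \<bullet> b) / (a \<bullet> a)) *\<^sub>R a"
  have wa: "w \<bullet> a = 0"
    using a0 by (simp add: w_def inner_diff_left inner_commute[of b a])
  have "w \<noteq> 0"
  proof
    assume "w = 0"
    then obtain c where "b = c *\<^sub>R a"
      by (auto simp: w_def)
    then show False
      using ab by auto
  qed
  moreover have "w \<bullet> b = w \<bullet> w"
    using wa by (subst (3) w_def) (simp add: inner_diff_right)
  ultimately have wb: "w \<bullet> b > 0" by simp
  have seg: "closed_segment a b \<subseteq> {x. w \<bullet> x \<ge> 0}"
    using wa wb by (auto simp: closed_segment_def inner_add_right)
  have ge: "w \<bullet> x \<ge> 0" if "x \<in> conic hull (closed_segment a b)" for x
    using that seg by (auto simp: conic_hull_explicit)
  have "conic hull {a} = conic hull (closed_segment a b) \<inter> {x. w \<bullet> x = 0}"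
  proof
    show "conic hull {a} \<subseteq> conic hull (closed_segment a b) \<inter> {x. w \<bullet> x = 0}"
      using wa by (auto simp: conic_hull_explicit)
    show "conic hull (closed_segment a b) \<inter> {x. w \<bullet> x = 0} \<subseteq> conic hull {a}"
    proof
      fix x assume x: "x \<in> conic hull (closed_segment a b) \<inter> {x. w \<bullet> x = 0}"
      then obtain c t where c: "c \<ge> 0" "x = c *\<^sub>R ((1 - t) *\<^sub>R a + t *\<^sub>R b)"
        by (auto simp: conic_hull_explicit closed_segment_def)
      then have "c * (t * (w \<bullet> b)) = 0"
        using x wa by (simp add: inner_add_right)
      then have "c = 0 \<or> t = 0"
        using wb by simp
      then show "x \<in> conic hull {a}"
        using c by (auto simp: conic_hull_explicit)
    qed
  qed
  moreover have "convex (conic hull (closed_segment a b))"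
    by (simp add: convex_conic_hull)
  ultimately show ?thesis
    using face_of_Int_supporting_hyperplane_ge[where a = w and b = 0] ge by simp
qed

lemma aff_dim_cone_over_segment:
  fixes a b u :: "'a::euclidean_space"
  assumes ab: "a \<noteq> b" "a \<bullet> u = 1" "b \<bullet> u = 1"
  shows "aff_dim (conic hull (closed_segment a b)) \<ge> 2"
proof -
  have a0: "a \<noteq> 0"
    using ab(2) by auto
  have "b \<notin> conic hull {a}"
  proof
    assume "b \<in> conic hull {a}"
    then obtain c where "b = c *\<^sub>R a"
      by (auto simp: conic_hull_explicit)
    then show False
      using ab by auto
  qed
  moreover have "b \<in> conic hull (closed_segment a b)"
    by (simp add: hull_inc)
  ultimately have "aff_dim (conic hull {a}) < aff_dim (conic hull (closed_segment a b))"
    using face_of_aff_dim_lt[OF _ ray_face_of_cone_over_segment[OF ab]] convex_conic_hull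
    by (metis convex_closed_segment)
  then show ?thesis
    using aff_dim_ray[OF a0] by simp
qed

text \<open>
  A face of the cone is a cone, hence it is spanned by its slice at height \<open>1\<close>, which is a face
  of the segment; in dimension one this slice is an end point.
\<close>
lemma ray_faces_of_cone_over_segment:
  fixes a b u :: "'a::euclidean_space"
  assumes ab: "a \<noteq> b" "a \<bullet> u = 1" "b \<bullet> u = 1"
  shows "{r. r face_of conic hull (closed_segment a b) \<and> aff_dim r = 1}
    = {conic hull {a}, conic hull {b}}"
proof -
  let ?S = "closed_segment a b"
  let ?L = "{x. u \<bullet> x = 1}"
  have S1: "x \<bullet> u = 1" if "x \<in> ?S" for x
    using that ab by (auto simp: closed_segment_def inner_add_left)
  have NL: "conic hull ?S \<inter> ?L = ?S"
    using S1 by (auto simp: conic_hull_explicit hull_inc inner_commute)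
      (metis scaleR_one zero_le_one)
  have "r \<in> {conic hull {a}, conic hull {b}}"
    if r: "r face_of conic hull ?S" "aff_dim r = 1" for r
  proof -
    have "conic r"
      using face_of_conic[OF conic_conic_hull r(1)] .
    have "conic hull (r \<inter> ?L) = r"
    proof
      show "conic hull (r \<inter> ?L) \<subseteq> r"
        by (rule hull_minimal) (use \<open>conic r\<close> in auto)
      show "r \<subseteq> conic hull (r \<inter> ?L)"
      proof
        fix w assume w: "w \<in> r"
        have sub: "w \<in> conic hull (r \<inter> ?L)" if "w \<in> r" "w \<noteq> 0" for w
        proof -
          have "w \<in> conic hull ?S"
            using \<open>w \<in> r\<close> face_of_imp_subset[OF r(1)] by auto
          then obtain t k where tk: "t \<ge> 0" "k \<in> ?S" "w = t *\<^sub>R k"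
            by (auto simp: conic_hull_explicit)
          then have "t > 0"
            using \<open>w \<noteq> 0\<close> by (cases "t = 0") auto
          then have "k = (1 / t) *\<^sub>R w"
            using tk by simp
          then have "k \<in> r"
            using conic_mul[OF \<open>conic r\<close> \<open>w \<in> r\<close>, of "1 / t"] \<open>t > 0\<close> by simp
          then have "k \<in> r \<inter> ?L"
            using S1[OF tk(2)] by (simp add: inner_commute)
          then show ?thesis
            using tk by (auto simp: conic_hull_explicit)
        qed
        \<comment> \<open>the origin lies in the hull as soon as the slice is non-empty\<close>
        have "r \<noteq> {0}"
          using r(2) by auto
        then obtain w' where "w' \<in> r" "w' \<noteq> 0"
          using w by blast
        then have "r \<inter> ?L \<noteq> {}"
          using sub[of w'] by auto
        then show "w \<in> conic hull (r \<inter> ?L)"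
          using sub[OF w] by (cases "w = 0") auto
      qed
    qed
    note r_eq = this
    have face: "r \<inter> ?L face_of ?S"
      using face_of_slice[OF r(1) convex_hyperplane[of u 1]] NL by simp
    have "r \<inter> ?L \<noteq> ?S"
      using r_eq r(2) aff_dim_cone_over_segment[OF ab] by auto
    then have "aff_dim (r \<inter> ?L) < aff_dim ?S"
      using face_of_aff_dim_lt[OF _ face] by simp
    also have "\<dots> \<le> 1"
      using collinear_aff_dim collinear_closed_segment by blast
    finally have "aff_dim (r \<inter> ?L) \<le> 0" by simp
    moreover have "r \<inter> ?L \<noteq> {}"
      using r_eq r(2) by (metis aff_dim_empty conic_hull_empty minus_equation_iff one_neq_neg_one)
    ultimately have "aff_dim (r \<inter> ?L) = 0"
      by (smt (verit) aff_dim_empty aff_dim_geq)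
    then obtain x where x: "r \<inter> ?L = {x}"
      using aff_dim_eq_0 by blast
    then have "x = a \<or> x = b"
      using face by (simp add: face_of_singleton extreme_point_of_segment)
    then show ?thesis
      using r_eq x by auto
  qed
  moreover have "conic hull {a} face_of conic hull ?S" "conic hull {b} face_of conic hull ?S"
    using ray_face_of_cone_over_segment[OF ab] ray_face_of_cone_over_segment[of b a u] ab
    by (auto simp: closed_segment_commute)
  moreover have "a \<noteq> 0" "b \<noteq> 0"
    using ab by auto
  ultimately show ?thesis
    using aff_dim_ray by auto
qed

section \<open>Corners of the polar of a planar body\<close>

lemma planar_orthogonal_collinear:
  fixes w x d :: "real^2"
  assumes "w \<noteq> 0" "x \<noteq> 0" "w \<bullet> x = 0" "w \<bullet> d = 0"
  obtains s where "d = s *\<^sub>R x"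
proof -
  have "aff_dim {y. w \<bullet> y = 0} = 1"
    using assms(1) by simp
  moreover have "{0, x, d} \<subseteq> {y. w \<bullet> y = 0}"
    using assms by auto
  ultimately have "collinear {0, x, d}"
    by (metis aff_dim_subset collinear_aff_dim)
  then show ?thesis
    using that assms(2) by (auto simp: collinear_lemma)
qed

text \<open>
  The average of two supporting functionals at \<open>x\<close> attains its maximum only where both do, and
  two distinct lines through \<open>x\<close> meet in \<open>x\<close> alone.
\<close>
lemma exposed_point_of_two_supports:
  fixes K :: "(real^2) set"
  assumes "convex K" "x \<in> K" "v \<in> polar_set K" "w \<in> polar_set K" "v \<noteq> w"
    and xv: "x \<bullet> v = 1" "x \<bullet> w = 1"
  shows "{x} exposed_face_of K"
proof -
  have "y = x" if y: "y \<bullet> v = 1" "y \<bullet> w = 1" for y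
  proof -
    have "x \<noteq> 0" "(v - w) \<bullet> x = 0" "(v - w) \<bullet> (y - x) = 0"
      using xv y by (auto simp: inner_diff_left inner_diff_right inner_commute)
    then obtain s where s: "y - x = s *\<^sub>R x"
      using planar_orthogonal_collinear[of "v - w"] assms(5) by (metis right_minus_eq)
    then have "(y - x) \<bullet> v = s * (x \<bullet> v)" by simp
    then have "s = 0"
      using xv y by (simp add: inner_diff_left)
    then show ?thesis
      using s by simp
  qed
  then have "support_slice K v \<inter> support_slice K w = {x}"
    unfolding support_slice_def using assms(2) xv by blast
  then show ?thesis
    using exposed_face_of_Int[OF support_slice_exposed[OF assms(1,3)]
      support_slice_exposed[OF assms(1,4)]] by simp
qed

lemma support_slice_collinear:
  fixes K :: "(real^2) set"
  shows "collinear (support_slice K u)"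
proof (cases "u = 0")
  case True
  then show ?thesis by (simp add: support_slice_def)
next
  case False
  have "aff_dim (support_slice K u) \<le> aff_dim {x. u \<bullet> x = 1}"
    by (rule aff_dim_subset) (auto simp: support_slice_def inner_commute)
  then show ?thesis
    using False by (simp add: collinear_aff_dim)
qed

text \<open>
  Inside the supporting slice that contains it, a non-exposed face is a proper face of a set of
  dimension at most one.
\<close>
lemma nonexposed_face_obtains:
  fixes K :: "(real^2) set"
  assumes "convex K" "0 \<in> interior K" "F face_of K" "\<not> F exposed_face_of K"
  obtains x u where "F = {x}" "u \<in> polar_set K" "x \<in> support_slice K u"
proof -
  have F: "F \<noteq> {}" "F \<noteq> K"
    using assms(1,4) by auto
  then obtain u where u: "u \<in> polar_set K" "F \<subseteq> support_slice K u"
    using proper_face_subset_support_slice assms by metis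
  have ex: "support_slice K u exposed_face_of K"
    using support_slice_exposed assms(1) u(1) by blast
  then have sK: "support_slice K u face_of K"
    by (simp add: exposed_face_of_def)
  have "F face_of support_slice K u"
    using face_of_subset[OF assms(3) u(2)] sK face_of_imp_subset by blast
  moreover have "F \<noteq> support_slice K u"
    using ex assms(4) by auto
  ultimately have "aff_dim F < aff_dim (support_slice K u)"
    using sK face_of_aff_dim_lt face_of_imp_convex by blast
  also have "\<dots> \<le> 1"
    using collinear_aff_dim support_slice_collinear by blast
  finally have "aff_dim F \<le> 0" by simp
  then have "aff_dim F = 0"
    using F(1) by (smt (verit) aff_dim_empty aff_dim_geq)
  then obtain x where "F = {x}"
    using aff_dim_eq_0 by blast
  then show ?thesis
    using u that by auto
qed

lemma support_slice_eq_segment: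
  fixes K :: "(real^2) set"
  assumes "convex K" "compact K" "u \<in> polar_set K" "support_slice K u \<noteq> {}"
  obtains a b where "support_slice K u = closed_segment a b"
proof -
  have "support_slice K u face_of K"
    using support_slice_exposed[OF assms(1,3)] by (simp add: exposed_face_of_def)
  then have "compact (support_slice K u)" "convex (support_slice K u)"
    using assms(1,2) face_of_imp_compact face_of_imp_convex by blast+
  then show ?thesis
    using compact_convex_collinear_segment[OF assms(4)] support_slice_collinear that by metis
qed

text \<open>
  The cone over a slice with at most one point is a ray or \<open>{0}\<close>, too small for a corner.
\<close>
lemma corner_imp_slice_segment:
  fixes K :: "(real^2) set"
  assumes K: "convex K" "compact K" "0 \<in> K" and c: "corner (polar_set K) u"
  obtains a b where "u \<in> polar_set K" "a \<noteq> b" "support_slice K u = closed_segment a b"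
proof -
  have u: "u \<in> polar_set K" and dim: "aff_dim (normal_cone (polar_set K) u) = 2"
    using c by (auto simp: corner_def extreme_point_of_def)
  have N: "normal_cone (polar_set K) u = insert 0 (conic hull (support_slice K u))"
    using normal_cone_polar_set[OF K u] .
  have "support_slice K u \<noteq> {}"
    using N dim by auto
  then obtain a b where ab: "support_slice K u = closed_segment a b"
    using support_slice_eq_segment K u by metis
  have "a \<noteq> b"
  proof
    assume "a = b"
    then have "support_slice K u = {a}"
      using ab by simp
    moreover have "a \<in> support_slice K u"
      using ab by simp
    then have "a \<noteq> 0"
      unfolding support_slice_def by auto
    ultimately show False
      using N dim aff_dim_ray[of a] by (simp add: insert_absorb)
  qed
  then show ?thesis
    using that u ab by blast
qed

text \<open>
  Mixed and free corners are defined by an existential labelling \<open>r1\<close>, \<open>r2\<close> of the two boundary rays;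
  this reduces it to the two possible labellings.
\<close>
lemma ex_doubleton_labelling:
  assumes "x \<noteq> y"
  shows "(\<exists>r1 r2. r1 \<noteq> r2 \<and> {x, y} = {r1, r2} \<and> P r1 \<and> Q r2)
    \<longleftrightarrow> P x \<and> Q y \<or> P y \<and> Q x"  (is "?L \<longleftrightarrow> ?R")
proof
  show ?R if ?L
    using that by (auto simp: doubleton_eq_iff)
  show ?L if ?R
    using that
  proof
    assume "P x \<and> Q y"
    then show ?L
      using assms by (intro exI[of _ x] exI[of _ y]) simp
  next
    assume "P y \<and> Q x"
    then show ?L
      using assms by (intro exI[of _ y] exI[of _ x]) auto
  qed
qed

context
  fixes K :: "(real^2) set" and u a b :: "real^2"
  assumes K: "convex K" "compact K" "0 \<in> interior K"
    and u: "u \<in> polar_set K"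
    and ab: "a \<noteq> b" and slice: "support_slice K u = closed_segment a b"
begin

lemma endpoints_in_slice: "a \<in> support_slice K u" "b \<in> support_slice K u"
  using slice by auto

lemma endpoints_height: "a \<bullet> u = 1" "b \<bullet> u = 1"
  using endpoints_in_slice by (auto simp: support_slice_def)

lemma normal_cone_at_slice:
  "normal_cone (polar_set K) u = conic hull (closed_segment a b)"
proof -
  have "0 \<in> K"
    using K(3) interior_subset by blast
  then show ?thesis
    using normal_cone_polar_set[OF K(1,2) _ u] slice by (simp add: insert_absorb)
qed

text \<open>
  Two distinct points of the slice are two supporting functionals of the polar at \<open>u\<close>, so they
  expose \<open>u\<close>.
\<close>
lemma corner_of_slice_segment: "corner (polar_set K) u"
proof -
  have "a \<in> polar_set (polar_set K)" "b \<in> polar_set (polar_set K)"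
    using endpoints_in_slice by (auto simp: support_slice_def polar_set_def inner_commute)
  then have "{u} exposed_face_of polar_set K"
    using exposed_point_of_two_supports[OF convex_polar_set u _ _ ab] endpoints_height
    by (simp add: inner_commute)
  then have "u extreme_point_of polar_set K"
    by (simp add: exposed_face_of_def face_of_singleton)
  moreover have "aff_dim (normal_cone (polar_set K) u) = 2"
    using aff_dim_cone_over_segment[OF ab endpoints_height] normal_cone_at_slice
      aff_dim_le_DIM[of "normal_cone (polar_set K) u"] by simp
  ultimately show ?thesis
    by (simp add: corner_def)
qed

lemma boundary_rays_of_slice_segment:
  "boundary_rays (polar_set K) u = {conic hull {a}, conic hull {b}}"
  "conic hull {a} \<noteq> conic hull {b}"
proof -
  show "boundary_rays (polar_set K) u = {conic hull {a}, conic hull {b}}"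
    unfolding boundary_rays_def normal_cone_at_slice
    using ray_faces_of_cone_over_segment[OF ab endpoints_height] .
  show "conic hull {a} \<noteq> conic hull {b}"
  proof
    assume "conic hull {a} = conic hull {b}"
    then have "b \<in> conic hull {a}"
      by (simp add: hull_inc)
    then obtain c where "b = c *\<^sub>R a"
      by (auto simp: conic_hull_explicit)
    then show False
      using ab endpoints_height by auto
  qed
qed

lemma mixed_corner_iff:
  "mixed_corner (polar_set K) u
    \<longleftrightarrow> ({a} exposed_face_of K) \<noteq> ({b} exposed_face_of K)"
proof -
  note rays = ray_in_normal_cones_polar_set_iff[OF K u endpoints_in_slice(1)]
    ray_in_normal_cones_polar_set_iff[OF K u endpoints_in_slice(2)]
  note label = ex_doubleton_labelling[OF boundary_rays_of_slice_segment(2)]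
  have "mixed_corner (polar_set K) u \<longleftrightarrow> (\<exists>r1 r2. r1 \<noteq> r2
      \<and> {conic hull {a}, conic hull {b}} = {r1, r2}
      \<and> r1 \<in> normal_cones (polar_set K) \<and> r2 \<notin> normal_cones (polar_set K))"
    by (simp only: mixed_corner_def boundary_rays_of_slice_segment(1) corner_of_slice_segment
        simp_thms)
  then show ?thesis
    unfolding label rays by argo
qed

lemma free_corner_iff:
  "free_corner (polar_set K) u
    \<longleftrightarrow> \<not> {a} exposed_face_of K \<and> \<not> {b} exposed_face_of K"
proof -
  note rays = ray_in_normal_cones_polar_set_iff[OF K u endpoints_in_slice(1)]
    ray_in_normal_cones_polar_set_iff[OF K u endpoints_in_slice(2)]
  note label = ex_doubleton_labelling[OF boundary_rays_of_slice_segment(2)]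
  have "free_corner (polar_set K) u \<longleftrightarrow> (\<exists>r1 r2. r1 \<noteq> r2
      \<and> {conic hull {a}, conic hull {b}} = {r1, r2}
      \<and> r1 \<notin> normal_cones (polar_set K) \<and> r2 \<notin> normal_cones (polar_set K))"
    by (simp only: free_corner_def boundary_rays_of_slice_segment(1) corner_of_slice_segment
        simp_thms)
  then show ?thesis
    unfolding label rays by argo
qed

end

text \<open>A second supporting line would expose the point.\<close>
lemma nonexposed_point_conjugate_face:
  fixes K :: "(real^2) set"
  assumes "convex K" "\<not> {x} exposed_face_of K" "u \<in> polar_set K" "x \<in> support_slice K u"
  shows "conjugate_face K {x} = {u}"
proof -
  have x: "x \<in> K" "x \<bullet> u = 1"
    using assms(4) by (simp_all add: support_slice_def)
  have "v = u" if "v \<in> polar_set K" "v \<bullet> x = 1" for v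
    using exposed_point_of_two_supports[OF assms(1) x(1) assms(3) that(1)] assms(2) x(2) that(2)
    by (metis inner_commute)
  moreover have "u \<bullet> x = 1"
    using x(2) by (simp add: inner_commute)
  ultimately show ?thesis
    unfolding conjugate_face_def using assms(3) by blast
qed

text \<open>
  A non-exposed face with conjugate \<open>{u}\<close> lies in the slice of \<open>u\<close>; being an extreme point of \<open>K\<close>, it is an
  end point of the slice. Both counts are counts of the set on the right.
\<close>
lemma nonexposed_fibre:
  fixes K :: "(real^2) set"
  assumes K: "convex K" "0 \<in> interior K" and u: "u \<in> polar_set K"
    and slice: "support_slice K u = closed_segment a b"
  shows "{F \<in> face_sets K - exposed_face_sets K. conjugate_face K F = {u}}
    = {F \<in> {{a}, {b}}. \<not> F exposed_face_of K}"
proof -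
  have sK: "support_slice K u face_of K"
    using support_slice_exposed[OF K(1) u] by (simp add: exposed_face_of_def)
  have ext: "{x} face_of K \<and> x \<in> support_slice K u \<longleftrightarrow> x = a \<or> x = b" for x
    using extreme_point_of_face[OF sK, of x] extreme_point_of_segment[of x a b]
    unfolding slice face_of_singleton by simp
  show ?thesis
  proof (intro set_eqI iffI)
    fix F assume "F \<in> {F \<in> face_sets K - exposed_face_sets K. conjugate_face K F = {u}}"
    then have F: "F face_of K" "\<not> F exposed_face_of K" "conjugate_face K F = {u}"
      by (auto simp: face_sets_def exposed_face_sets_def)
    obtain x where x: "F = {x}"
      using nonexposed_face_obtains[OF K F(1,2)] by metis
    have "x \<in> K"
      using F(1) x face_of_imp_subset by blast
    moreover have "u \<in> conjugate_face K {x}"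
      using F(3) x by simp
    ultimately have "x \<in> support_slice K u"
      by (simp add: conjugate_face_def support_slice_def inner_commute)
    then show "F \<in> {F \<in> {{a}, {b}}. \<not> F exposed_face_of K}"
      using ext[of x] F x by auto
  next
    fix F assume "F \<in> {F \<in> {{a}, {b}}. \<not> F exposed_face_of K}"
    then obtain x where x: "F = {x}" "x = a \<or> x = b" "\<not> {x} exposed_face_of K" by auto
    then have "{x} face_of K" "x \<in> support_slice K u"
      using ext by blast+
    then show "F \<in> {F \<in> face_sets K - exposed_face_sets K. conjugate_face K F = {u}}"
      using x nonexposed_point_conjugate_face[OF K(1) x(3) u]
      by (simp add: face_sets_def exposed_face_sets_def)
  qed
qed

text \<open>
  The slice through a non-exposed point has two distinct end points, at least one of them
  non-exposed; this is exactly what makes its corner mixed or free.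
\<close>
lemma conjugate_face_nonexposed_image:
  fixes K :: "(real^2) set"
  assumes K: "convex K" "compact K" "0 \<in> interior K"
  shows "conjugate_face K ` (face_sets K - exposed_face_sets K)
    = mixed_corners (polar_set K) \<union> free_corners (polar_set K)"
proof (intro set_eqI iffI)
  fix G assume "G \<in> conjugate_face K ` (face_sets K - exposed_face_sets K)"
  then obtain F where F: "F face_of K" "\<not> F exposed_face_of K" "G = conjugate_face K F"
    by (auto simp: face_sets_def exposed_face_sets_def)
  obtain x u where x: "F = {x}" "u \<in> polar_set K" "x \<in> support_slice K u"
    using nonexposed_face_obtains[OF K(1,3) F(1,2)] by metis
  then have G: "G = {u}"
    using nonexposed_point_conjugate_face F K(1) by blast
  obtain a b where ab: "support_slice K u = closed_segment a b"
    using support_slice_eq_segment[OF K(1,2) x(2)] x(3) by blast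
  have "F \<in> {F \<in> {{a}, {b}}. \<not> F exposed_face_of K}"
    using nonexposed_fibre[OF K(1,3) x(2) ab] F G
    by (auto simp: face_sets_def exposed_face_sets_def)
  then have ne: "\<not> {a} exposed_face_of K \<or> \<not> {b} exposed_face_of K"
    by auto
  have "a \<noteq> b"
    using ne support_slice_exposed[OF K(1) x(2)] ab by auto
  then have "mixed_corner (polar_set K) u \<or> free_corner (polar_set K) u"
    using mixed_corner_iff[OF K x(2) _ ab] free_corner_iff[OF K x(2) _ ab] ne by blast
  then show "G \<in> mixed_corners (polar_set K) \<union> free_corners (polar_set K)"
    using G by (auto simp: mixed_corners_def free_corners_def)
next
  fix G assume "G \<in> mixed_corners (polar_set K) \<union> free_corners (polar_set K)"
  then obtain u where G: "G = {u}"
    and c: "mixed_corner (polar_set K) u \<or> free_corner (polar_set K) u"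
    by (auto simp: mixed_corners_def free_corners_def)
  then have "corner (polar_set K) u"
    by (auto simp: mixed_corner_def free_corner_def)
  then obtain a b where ab: "u \<in> polar_set K" "a \<noteq> b" "support_slice K u = closed_segment a b"
    using corner_imp_slice_segment K interior_subset by (metis subsetD)
  have "\<not> {a} exposed_face_of K \<or> \<not> {b} exposed_face_of K"
    using c mixed_corner_iff[OF K ab] free_corner_iff[OF K ab] by blast
  then have "{F \<in> face_sets K - exposed_face_sets K. conjugate_face K F = {u}} \<noteq> {}"
    unfolding nonexposed_fibre[OF K(1,3) ab(1,3)] by blast
  then show "G \<in> conjugate_face K ` (face_sets K - exposed_face_sets K)"
    using G by blast
qed

theorem lemma5p2:
  fixes K :: "(real^2) set"
  assumes "convex K" and "compact K" and "0 \<in> interior K"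
  shows "conjugate_face K ` face_sets K \<subseteq> exposed_face_sets (polar_set K) \<and>
    conjugate_face K ` (face_sets K - exposed_face_sets K)
      = mixed_corners (polar_set K) \<union> free_corners (polar_set K) \<and>
    (\<forall>G\<in>mixed_corners (polar_set K). card {F \<in> mixed_faces K. conjugate_face K F = G} = 1) \<and>
    (\<forall>G\<in>free_corners (polar_set K). card {F \<in> free_faces K. conjugate_face K F = G} = 2)"
proof (intro conjI ballI)
  have K0: "0 \<in> K"
    using assms(3) interior_subset by blast
  show "conjugate_face K ` face_sets K \<subseteq> exposed_face_sets (polar_set K)"
    unfolding face_sets_def exposed_face_sets_def
    using conjugate_face_exposed[OF face_of_imp_subset] by blast
  show "conjugate_face K ` (face_sets K - exposed_face_sets K)
      = mixed_corners (polar_set K) \<union> free_corners (polar_set K)"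
    using conjugate_face_nonexposed_image assms by blast
  show "card {F \<in> mixed_faces K. conjugate_face K F = G} = 1"
    if G: "G \<in> mixed_corners (polar_set K)" for G
  proof -
    obtain u where u: "G = {u}" "mixed_corner (polar_set K) u"
      using G by (auto simp: mixed_corners_def)
    then obtain a b where ab: "u \<in> polar_set K" "a \<noteq> b" "support_slice K u = closed_segment a b"
      using corner_imp_slice_segment[OF assms(1,2) K0] by (metis mixed_corner_def)
    have "{F \<in> mixed_faces K. conjugate_face K F = G} = {F \<in> {{a}, {b}}. \<not> F exposed_face_of K}"
      unfolding mixed_faces_def nonexposed_fibre[OF assms(1,3) ab(1,3), symmetric]
      using G unfolding u(1) by auto
    moreover have "{F \<in> {{a}, {b}}. \<not> F exposed_face_of K} = {{a}}
        \<or> {F \<in> {{a}, {b}}. \<not> F exposed_face_of K} = {{b}}"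
      using u(2) unfolding mixed_corner_iff[OF assms ab] by blast
    ultimately show ?thesis by auto
  qed
  show "card {F \<in> free_faces K. conjugate_face K F = G} = 2"
    if G: "G \<in> free_corners (polar_set K)" for G
  proof -
    obtain u where u: "G = {u}" "free_corner (polar_set K) u"
      using G by (auto simp: free_corners_def)
    then obtain a b where ab: "u \<in> polar_set K" "a \<noteq> b" "support_slice K u = closed_segment a b"
      using corner_imp_slice_segment[OF assms(1,2) K0] by (metis free_corner_def)
    have "{F \<in> free_faces K. conjugate_face K F = G} = {F \<in> {{a}, {b}}. \<not> F exposed_face_of K}"
      unfolding free_faces_def nonexposed_fibre[OF assms(1,3) ab(1,3), symmetric]
      using G unfolding u(1) by auto
    also have "\<dots> = {{a}, {b}}"
      using u(2) unfolding free_corner_iff[OF assms ab] by blast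
    finally show ?thesis
      using ab(2) by simp
  qed
qed

end
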